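(* Let $A\in\mathbb{R}^{m\times n}$, $L\in\mathbb{R}^{p\times n}$, $M=A^{\top}A+L^{\top}L$, and let $b\in\mathbb{R}^m$ be nonzero. Run the gGKB process for $(A,M)$ with starting vector $b$ (described in the context) and let $k\ge1$ be such that it does not terminate before the $k$-th step, i.e. $\alpha_i\beta_i\ne0$ for $1\le i\le k$. Let $B_k=Y_k\Theta_kH_k^{\top}$ be the compact SVD of the bidiagonal matrix $B_k\in\mathbb{R}^{(k+1)\times k}$, with $\Theta_k=\mathrm{diag}(\theta_1^{(k)},\dots,\theta_k^{(k)})$, $\theta_1^{(k)}>\cdots>\theta_k^{(k)}>0$, $Y_k=(y_1^{(k)},\dots,y_k^{(k)})$ and $H_k=(h_1^{(k)},\dots,h_k^{(k)})$ having orthonormal columns. For $1\le i\le k$ put $$\bigl(\bar c_i^{(k)},\bar s_i^{(k)},\bar p_{A,i}^{(k)},\bar x_i^{(k)}\bigr)=\bigl(\theta_i^{(k)},\,(1-(\theta_i^{(k)})^2)^{1/2},\,U_{k+1}y_i^{(k)},\,V_kh_i^{(k)}\bigr).$$ Then for each $1\le i\le k$ $$(\bar s_i^{(k)})^2A^{\top}A\bar x_i^{(k)}-(\bar c_i^{(k)})^2L^{\top}L\bar x_i^{(k)}=\alpha_{k+1}\beta_{k+1}\,Mv_{k+1}\,e_k^{\top}h_i^{(k)},$$ where $e_k$ is the $k$-th column of $I_k$.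
   Context: $M^{\dag}$ is the Moore-Penrose pseudoinverse and $\|v\|_M=(v^{\top}Mv)^{1/2}$, a norm on the column space $\mathcal{R}(M)$. gGKB process (Euclidean inner product on $\mathbb{R}^m$): $v_0=\mathbf{0}$, $\beta_1u_1=b$, and for $i\ge1$ $$\alpha_iv_i=M^{\dag}A^{\top}u_i-\beta_iv_{i-1},\qquad \beta_{i+1}u_{i+1}=Av_i-\alpha_iu_i,$$ where $\alpha_i\ge0,\beta_i\ge0$ are chosen so that $\|v_i\|_M=\|u_i\|_2=1$ (normalization of the right-hand sides). Convention at termination: if $\beta_{k+1}=0$ then $u_{k+1}=\mathbf{0}$, $\alpha_{k+1}=0$ and $v_{k+1}=\mathbf{0}$; if $\alpha_{k+1}=0$ then $v_{k+1}=\mathbf{0}$. Set $U_{k+1}=(u_1,\dots,u_{k+1})$, $V_k=(v_1,\dots,v_k)$, and let $B_k\in\mathbb{R}^{(k+1)\times k}$ be the lower bidiagonal matrix with diagonal entries $(B_k)_{ii}=\alpha_i$ and subdiagonal entries $(B_k)_{i+1,i}=\beta_{i+1}$, $1\le i\le k$, all other entries zero. *)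

theory Defs
  imports Complex_Main "Jordan_Normal_Form.Matrix"
begin

section \<open>The Moore--Penrose pseudoinverse\<close>

definition is_pinv :: "real mat \<Rightarrow> real mat \<Rightarrow> bool" where
  "is_pinv A X \<longleftrightarrow> X \<in> carrier_mat (dim_col A) (dim_row A) \<and>
     A * X * A = A \<and> X * A * X = X \<and>
     transpose_mat (A * X) = A * X \<and> transpose_mat (X * A) = X * A"

definition pinv :: "real mat \<Rightarrow> real mat" where
  "pinv A = (THE X. is_pinv A X)"

text \<open>Well-definedness: existence (by solving the normal equations) and uniqueness.\<close>

lemma normal_equations_solvable:
  fixes f :: "nat \<Rightarrow> nat \<Rightarrow> real"
  shows "\<exists>c. \<forall>j<n. (\<Sum>i<m. f j i * (b i - (\<Sum>l<n. c l * f l i))) = 0"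
proof (induction n arbitrary: b)
  case 0
  show ?case by simp
next
  case (Suc n)
  obtain ca where ca: "\<And>j. j < n \<Longrightarrow> (\<Sum>i<m. f j i * (f n i - (\<Sum>l<n. ca l * f l i))) = 0"
    using Suc.IH[of "f n"] by blast
  obtain cb where cb: "\<And>j. j < n \<Longrightarrow> (\<Sum>i<m. f j i * (b i - (\<Sum>l<n. cb l * f l i))) = 0"
    using Suc.IH[of b] by blast
  define r where "r i = f n i - (\<Sum>l<n. ca l * f l i)" for i
  define s where "s i = b i - (\<Sum>l<n. cb l * f l i)" for i
  define t where "t = (if (\<Sum>i<m. r i * r i) = 0 then 0 else (\<Sum>i<m. r i * s i) / (\<Sum>i<m. r i * r i))"
  define c where "c l = (if l = n then t else cb l - t * ca l)" for l
  have res: "b i - (\<Sum>l<Suc n. c l * f l i) = s i - t * r i" for i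
  proof -
    have "(\<Sum>l<n. c l * f l i) = (\<Sum>l<n. cb l * f l i) - t * (\<Sum>l<n. ca l * f l i)"
      by (simp add: c_def sum_distrib_left sum_subtractf[symmetric] algebra_simps)
    then show ?thesis by (simp add: s_def r_def c_def algebra_simps)
  qed
  have old: "(\<Sum>i<m. f j i * (s i - t * r i)) = 0" if "j < n" for j
  proof -
    have "(\<Sum>i<m. f j i * (s i - t * r i)) = (\<Sum>i<m. f j i * s i) - t * (\<Sum>i<m. f j i * r i)"
      by (simp add: sum_distrib_left sum_subtractf[symmetric] algebra_simps)
    then show ?thesis using ca[OF that] cb[OF that] by (simp add: r_def s_def)
  qed
  have rr: "(\<Sum>i<m. r i * (s i - t * r i)) = 0"
  proof -
    have eq: "(\<Sum>i<m. r i * (s i - t * r i)) = (\<Sum>i<m. r i * s i) - t * (\<Sum>i<m. r i * r i)"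
      by (simp add: sum_distrib_left sum_subtractf[symmetric] algebra_simps)
    show ?thesis
    proof (cases "(\<Sum>i<m. r i * r i) = 0")
      case True
      then have "\<And>i. i < m \<Longrightarrow> r i = 0"
        by (subst (asm) sum_nonneg_eq_0_iff) auto
      then show ?thesis by simp
    next
      case False
      then show ?thesis using eq by (simp add: t_def)
    qed
  qed
  have new: "(\<Sum>i<m. f n i * (s i - t * r i)) = 0"
  proof -
    have "(\<Sum>i<m. f n i * (s i - t * r i)) =
        (\<Sum>i<m. r i * (s i - t * r i)) + (\<Sum>i<m. \<Sum>l<n. ca l * (f l i * (s i - t * r i)))"
    proof (subst sum.distrib[symmetric], rule sum.cong[OF refl])
      fix i
      have "f n i = r i + (\<Sum>l<n. ca l * f l i)" by (simp add: r_def)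
      then have "f n i * (s i - t * r i) =
          r i * (s i - t * r i) + (\<Sum>l<n. ca l * f l i) * (s i - t * r i)"
        by (simp only: distrib_right)
      then show "f n i * (s i - t * r i) =
          r i * (s i - t * r i) + (\<Sum>l<n. ca l * (f l i * (s i - t * r i)))"
        by (simp only: sum_distrib_right mult.assoc)
    qed
    also have "(\<Sum>i<m. \<Sum>l<n. ca l * (f l i * (s i - t * r i))) =
        (\<Sum>l<n. ca l * (\<Sum>i<m. f l i * (s i - t * r i)))"
      by (subst sum.swap) (simp add: sum_distrib_left)
    also have "\<dots> = 0" by (simp add: old)
    finally show ?thesis by (simp add: rr)
  qed
  show ?case
    by (rule exI[of _ c]) (use old new in \<open>auto simp only: res less_Suc_eq\<close>)
qed

lemma normal_equations_solvable_mat: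
  assumes A: "(A :: real mat) \<in> carrier_mat m n"
  shows "\<exists>G \<in> carrier_mat n m. transpose_mat A * (A * G) = transpose_mat A"
proof -
  have "\<forall>k. \<exists>c. \<forall>j<n. (\<Sum>i<m. A $$ (i,j) *
      ((if i = k then 1 else 0) - (\<Sum>l<n. c l * A $$ (i,l)))) = 0"
    by (rule allI, rule normal_equations_solvable[where f = "\<lambda>j i. A $$ (i,j)"])
  then have "\<exists>c. \<forall>k. \<forall>j<n. (\<Sum>i<m. A $$ (i,j) *
      ((if i = k then 1 else 0) - (\<Sum>l<n. c k l * A $$ (i,l)))) = 0"
    by (rule choice)
  then obtain c where c: "\<And>k j. j < n \<Longrightarrow> (\<Sum>i<m. A $$ (i,j) *
      ((if i = k then 1 else 0) - (\<Sum>l<n. c k l * A $$ (i,l)))) = 0"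
    by blast
  define G where "G = mat n m (\<lambda>(l,k). c k l)"
  have "transpose_mat A * (A * G) = transpose_mat A"
  proof (rule eq_matI)
    fix j k assume jk: "j < dim_row (transpose_mat A)" "k < dim_col (transpose_mat A)"
    have "(\<Sum>i<m. A $$ (i,j) * (if i = k then 1 else 0)) = A $$ (k,j)"
      using jk A by (simp add: if_distrib[of "\<lambda>x. _ * x"] cong: if_cong)
    moreover have "(\<Sum>i<m. A $$ (i,j) * (if i = k then 1 else 0))
        = (\<Sum>i<m. A $$ (i,j) * (\<Sum>l<n. c k l * A $$ (i,l)))"
      using c[of j k] jk A by (simp add: right_diff_distrib sum_subtractf)
    ultimately show "(transpose_mat A * (A * G)) $$ (j,k) = transpose_mat A $$ (j,k)"
      using jk A by (simp add: G_def scalar_prod_def lessThan_atLeast0 mult.commute)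
  qed (use A in \<open>auto simp: G_def\<close>)
  moreover have "G \<in> carrier_mat n m" by (simp add: G_def)
  ultimately show ?thesis by blast
qed

lemma inner_inverse_symmetric:
  assumes A: "(A :: real mat) \<in> carrier_mat m n"
  shows "\<exists>G \<in> carrier_mat n m. A * G * A = A \<and> transpose_mat (A * G) = A * G"
proof -
  obtain G where G: "G \<in> carrier_mat n m" and eq: "transpose_mat A * (A * G) = transpose_mat A"
    using normal_equations_solvable_mat[OF A] by blast
  have AG: "A * G \<in> carrier_mat m m" using A G by auto
  have AT: "transpose_mat A \<in> carrier_mat n m" using A by auto
  have GT: "transpose_mat G \<in> carrier_mat m n" using G by auto
  have 1: "transpose_mat (A * G) * A = A"
    using arg_cong[OF eq, of transpose_mat] transpose_mult[OF AT AG] by simp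
  have "transpose_mat (A * G) * (A * G) = (transpose_mat (A * G) * A) * G"
    using A G AG by (intro assoc_mult_mat[symmetric]) auto
  then have 2: "transpose_mat (A * G) * (A * G) = A * G" using 1 by simp
  have "transpose_mat (transpose_mat (A * G) * (A * G)) = transpose_mat (A * G) * (A * G)"
    using AG by (subst transpose_mult[of _ m m _ m]) auto
  then have 3: "transpose_mat (A * G) = A * G" by (simp add: 2)
  show ?thesis using G 1 3 by auto
qed

lemma is_pinv_exists: "\<exists>X. is_pinv A X"
proof -
  define m n where "m = dim_row A" and "n = dim_col A"
  have A: "A \<in> carrier_mat m n" by (simp add: m_def n_def)
  have AT: "transpose_mat A \<in> carrier_mat n m" using A by simp
  obtain G where G: "G \<in> carrier_mat n m" "A * G * A = A" "transpose_mat (A * G) = A * G"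
    using inner_inverse_symmetric[OF A] by blast
  obtain H where H: "H \<in> carrier_mat m n" "transpose_mat A * H * transpose_mat A = transpose_mat A"
      "transpose_mat (transpose_mat A * H) = transpose_mat A * H"
    using inner_inverse_symmetric[OF AT] by blast
  define F where "F = transpose_mat H"
  have F: "F \<in> carrier_mat n m" using H by (simp add: F_def)
  have FA: "transpose_mat A * H = F * A"
    using H(3) transpose_mult[OF AT H(1)] by (simp add: F_def)
  have symFA: "transpose_mat (F * A) = F * A" using H(3) FA by simp
  have "transpose_mat (F * A * transpose_mat A) = A"
    using H(2) FA by simp
  moreover have "transpose_mat (F * A * transpose_mat A) = A * (F * A)"
    using A F by (subst transpose_mult[of _ n n _ m]) (auto simp: symFA)
  ultimately have AFA: "A * (F * A) = A" by simp
  define X where "X = F * A * G"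
  have X: "X \<in> carrier_mat n m" using A F G by (simp add: X_def)
  have FAc: "F * A \<in> carrier_mat n n" using A F by simp
  have AX: "A * X = A * G"
    using assoc_mult_mat[OF A FAc G(1)] AFA by (simp add: X_def)
  have XA: "X * A = F * A"
    using assoc_mult_mat[OF FAc G(1) A] assoc_mult_mat[OF F A, of "G * A" n]
      assoc_mult_mat[OF A G(1) A] A G by (simp add: X_def)
  have XAX: "X * A * X = X"
    using assoc_mult_mat[OF FAc FAc G(1)] assoc_mult_mat[OF F A FAc] AFA
    by (simp add: XA) (simp add: X_def)
  have "is_pinv A X"
    unfolding is_pinv_def
    using X A G symFA XAX by (simp add: AX XA)
  then show ?thesis by blast
qed

lemma is_pinv_unique:
  assumes "is_pinv A X" and "is_pinv A Y"
  shows "X = Y"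
proof -
  define m n where "m = dim_row A" and "n = dim_col A"
  have A: "A \<in> carrier_mat m n" by (simp add: m_def n_def)
  have X: "X \<in> carrier_mat n m" "A * X * A = A" "X * A * X = X"
      "transpose_mat (A * X) = A * X" "transpose_mat (X * A) = X * A"
    using assms(1) by (auto simp: is_pinv_def m_def n_def)
  have Y: "Y \<in> carrier_mat n m" "A * Y * A = A" "Y * A * Y = Y"
      "transpose_mat (A * Y) = A * Y" "transpose_mat (Y * A) = Y * A"
    using assms(2) by (auto simp: is_pinv_def m_def n_def)
  have AX: "A * X \<in> carrier_mat m m" and AY: "A * Y \<in> carrier_mat m m"
    and XA: "X * A \<in> carrier_mat n n" and YA: "Y * A \<in> carrier_mat n n"
    using A X Y by auto
  have "A * X = (A * Y) * (A * X)"
    using assoc_mult_mat[OF AY A X(1)] Y(2) by simp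
  also have "\<dots> = transpose_mat ((A * X) * (A * Y))"
    using transpose_mult[OF AX AY] X(4) Y(4) by simp
  also have "\<dots> = A * Y"
    using assoc_mult_mat[OF AX A Y(1)] X(2) Y(4) by simp
  finally have 1: "A * X = A * Y" .
  have "X * A = (X * A) * (Y * A)"
    using assoc_mult_mat[OF X(1) A YA] assoc_mult_mat[OF A Y(1) A] Y(2) by simp
  also have "\<dots> = transpose_mat ((Y * A) * (X * A))"
    using transpose_mult[OF YA XA] X(5) Y(5) by simp
  also have "\<dots> = Y * A"
    using assoc_mult_mat[OF Y(1) A XA] assoc_mult_mat[OF A X(1) A] X(2) Y(5) by simp
  finally have 2: "X * A = Y * A" .
  have "X = X * (A * X)" using assoc_mult_mat[OF X(1) A X(1)] X(3) by simp
  also have "\<dots> = X * A * Y" using 1 assoc_mult_mat[OF X(1) A Y(1)] by simp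
  also have "\<dots> = Y" using 2 Y(3) by simp
  finally show ?thesis .
qed

lemma is_pinv_pinv: "is_pinv A (pinv A)"
  unfolding pinv_def by (rule theI') (use is_pinv_exists is_pinv_unique in blast)


section \<open>The gGKB process\<close>

definition norm2 :: "real vec \<Rightarrow> real" where
  "norm2 w = sqrt (w \<bullet> w)"

definition normM :: "real mat \<Rightarrow> real vec \<Rightarrow> real" where
  "normM M w = sqrt (w \<bullet> (M *\<^sub>v w))"

text \<open>Index \<open>i \<ge> 1\<close> gives \<open>(\<alpha>\<^sub>i, \<beta>\<^sub>i, u\<^sub>i, v\<^sub>i)\<close>; at index 0 only
  \<open>v\<^sub>0 = 0\<close> is meaningful.  Both right-hand sides are normalised by dividing by their norm, and
  since \<open>1 / 0 = 0\<close>, a right-hand side of norm 0 yields a zero vector.  So \<open>\<beta>\<^sub>i = 0\<close> gives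
  \<open>u\<^sub>i = 0\<close>, \<open>\<alpha>\<^sub>i = 0\<close> and \<open>v\<^sub>i = 0\<close>, and \<open>\<alpha>\<^sub>i = 0\<close> gives \<open>v\<^sub>i = 0\<close>,
  which is the convention at termination.  The vectors normalised with
  \<open>normM M\<close> lie in the column space of \<open>M\<close>, where it is a norm.\<close>

primrec gGKB :: "real mat \<Rightarrow> real mat \<Rightarrow> real vec \<Rightarrow> nat \<Rightarrow> real \<times> real \<times> real vec \<times> real vec"
where
  "gGKB A M b 0 = (0, 0, 0\<^sub>v (dim_row A), 0\<^sub>v (dim_col A))"
| "gGKB A M b (Suc i) = (case gGKB A M b i of (\<alpha>, \<beta>, u, v) \<Rightarrow>
     let w = (if i = 0 then b else A *\<^sub>v v - \<alpha> \<cdot>\<^sub>v u);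
         \<beta>' = norm2 w;
         u' = (1 / \<beta>') \<cdot>\<^sub>v w;
         z = pinv M *\<^sub>v (transpose_mat A *\<^sub>v u') - \<beta>' \<cdot>\<^sub>v v;
         \<alpha>' = normM M z;
         v' = (1 / \<alpha>') \<cdot>\<^sub>v z
     in (\<alpha>', \<beta>', u', v'))"

definition gGKB_alpha :: "real mat \<Rightarrow> real mat \<Rightarrow> real vec \<Rightarrow> nat \<Rightarrow> real" where
  "gGKB_alpha A M b i = fst (gGKB A M b i)"

definition gGKB_beta :: "real mat \<Rightarrow> real mat \<Rightarrow> real vec \<Rightarrow> nat \<Rightarrow> real" where
  "gGKB_beta A M b i = fst (snd (gGKB A M b i))"

definition gGKB_u :: "real mat \<Rightarrow> real mat \<Rightarrow> real vec \<Rightarrow> nat \<Rightarrow> real vec" where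
  "gGKB_u A M b i = fst (snd (snd (gGKB A M b i)))"

definition gGKB_v :: "real mat \<Rightarrow> real mat \<Rightarrow> real vec \<Rightarrow> nat \<Rightarrow> real vec" where
  "gGKB_v A M b i = snd (snd (snd (gGKB A M b i)))"

definition gGKB_U :: "real mat \<Rightarrow> real mat \<Rightarrow> real vec \<Rightarrow> nat \<Rightarrow> real mat" where
  "gGKB_U A M b j = mat_of_cols (dim_row A) (map (gGKB_u A M b) [1..<Suc j])"

definition gGKB_V :: "real mat \<Rightarrow> real mat \<Rightarrow> real vec \<Rightarrow> nat \<Rightarrow> real mat" where
  "gGKB_V A M b j = mat_of_cols (dim_col A) (map (gGKB_v A M b) [1..<Suc j])"

text \<open>Matrix entries are indexed from 0: position \<open>(j, j)\<close> holds \<open>\<alpha>\<^bsub>j+1\<^esub>\<close> and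
  position \<open>(j + 1, j)\<close> holds \<open>\<beta>\<^bsub>j+2\<^esub>\<close>.\<close>

definition gGKB_B :: "real mat \<Rightarrow> real mat \<Rightarrow> real vec \<Rightarrow> nat \<Rightarrow> real mat" where
  "gGKB_B A M b k = mat (k + 1) k (\<lambda>(i, j).
     if i = j then gGKB_alpha A M b (j + 1)
     else if i = j + 1 then gGKB_beta A M b (j + 2)
     else 0)"


section \<open>Compact singular value decomposition\<close>

text \<open>Compact SVD of a matrix with \<open>r\<close> nonzero singular values, all distinct and listed in
  decreasing order as \<open>\<theta> 0, \<dots>, \<theta> (r - 1)\<close>.\<close>

definition compact_svd :: "real mat \<Rightarrow> nat \<Rightarrow> real mat \<Rightarrow> (nat \<Rightarrow> real) \<Rightarrow> real mat \<Rightarrow> bool" where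
  "compact_svd B r Y \<theta> H \<longleftrightarrow>
     Y \<in> carrier_mat (dim_row B) r \<and> H \<in> carrier_mat (dim_col B) r \<and>
     transpose_mat Y * Y = 1\<^sub>m r \<and> transpose_mat H * H = 1\<^sub>m r \<and>
     (\<forall>i<r. \<theta> i > 0) \<and> (\<forall>i j. i < j \<and> j < r \<longrightarrow> \<theta> i > \<theta> j) \<and>
     B = Y * mat_diag r \<theta> * transpose_mat H"

end

theory Submission
  imports Defs
begin

text \<open>
  The process satisfies \<open>A V = U B\<close> and
  \<open>A\<^sup>T U = M V B\<^sup>T + \<alpha>\<^bsub>k+1\<^esub> M v\<^bsub>k+1\<^esub> e\<^bsub>k+1\<^esub>\<^sup>T\<close>. Applying these to
  \<open>B h = \<theta> y\<close> and \<open>B\<^sup>T y = \<theta> h\<close> gives, for \<open>x = V h\<close>,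
  \<open>A\<^sup>T A x = \<theta>\<^sup>2 M x + \<alpha>\<^bsub>k+1\<^esub> \<beta>\<^bsub>k+1\<^esub> h\<^sub>k M v\<^bsub>k+1\<^esub>\<close>, which is the claim once
  \<open>s\<^sup>2 = 1 - \<theta>\<^sup>2\<close>. The latter requires \<open>\<theta> \<le> 1\<close>. This follows from the orthonormality
  of the \<open>u\<^sub>i\<close> and the \<open>M\<close>-orthonormality of the \<open>v\<^sub>i\<close>, because
  \<open>\<theta>\<^sup>2 = \<parallel>A x\<parallel>\<^sup>2 \<le> \<parallel>x\<parallel>\<^sub>M\<^sup>2 = 1\<close>.
\<close>

section \<open>Inner products and matrix-vector products\<close>

lemma scalar_prod_self_nonneg: "(w :: real vec) \<bullet> w \<ge> 0"
  by (simp add: scalar_prod_def sum_nonneg)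

lemma scalar_prod_self_eq_0:
  assumes "(w :: real vec) \<in> carrier_vec n" and "w \<bullet> w = 0"
  shows "w = 0\<^sub>v n"
proof (rule eq_vecI)
  fix i assume "i < dim_vec (0\<^sub>v n)"
  moreover have "\<forall>i\<in>{0..<n}. w $ i * w $ i = 0"
    using assms by (subst sum_nonneg_eq_0_iff[symmetric]) (auto simp: scalar_prod_def)
  ultimately show "w $ i = 0\<^sub>v n $ i" by auto
qed (use assms in auto)

lemma scalar_prod_mult_mat_vec:
  fixes A :: "'a :: comm_semiring_0 mat"
  assumes "A \<in> carrier_mat m n" and "x \<in> carrier_vec n" and "y \<in> carrier_vec m"
  shows "x \<bullet> (transpose_mat A *\<^sub>v y) = (A *\<^sub>v x) \<bullet> y"
  using transpose_vec_mult_scalar[OF assms]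
    comm_scalar_prod[of x n "transpose_mat A *\<^sub>v y"] comm_scalar_prod[of "A *\<^sub>v x" m y] assms
  by simp

lemma mult_mat_zero_vec:
  fixes A :: "'a :: semiring_0 mat"
  assumes "A \<in> carrier_mat m n"
  shows "A *\<^sub>v 0\<^sub>v n = 0\<^sub>v m"
  using assms by (intro eq_vecI) auto

lemma mult_mat_unit_vec:
  fixes A :: "'a :: semiring_1 mat"
  assumes "A \<in> carrier_mat m n" and "j < n"
  shows "A *\<^sub>v unit_vec n j = col A j"
  using assms by (intro eq_vecI) auto

lemma mat_diag_mult_vec:
  fixes z :: "'a :: semiring_0 vec"
  assumes "z \<in> carrier_vec n"
  shows "mat_diag n f *\<^sub>v z = vec n (\<lambda>i. f i * z $ i)"
proof (rule eq_vecI)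
  fix i assume "i < dim_vec (vec n (\<lambda>i. f i * z $ i))"
  then show "(mat_diag n f *\<^sub>v z) $ i = vec n (\<lambda>i. f i * z $ i) $ i"
    using assms
    by (simp add: mat_diag_def scalar_prod_def if_distrib[of "\<lambda>x. x * _"] cong: if_cong)
qed (auto simp: mat_diag_def)

lemma norm2_sq: "(norm2 w)\<^sup>2 = w \<bullet> w"
  by (simp add: norm2_def scalar_prod_self_nonneg)

section \<open>Singular vector relations from the compact SVD\<close>

lemma compact_svd_right:
  assumes "compact_svd B r Y \<theta> H" and "i < r"
  shows "B *\<^sub>v col H i = \<theta> i \<cdot>\<^sub>v col Y i"
proof -
  have Y: "Y \<in> carrier_mat (dim_row B) r" and H: "H \<in> carrier_mat (dim_col B) r"
    and HH: "transpose_mat H * H = 1\<^sub>m r" and B: "B = Y * mat_diag r \<theta> * transpose_mat H"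
    using assms by (auto simp: compact_svd_def)
  have "Y * mat_diag r \<theta> * transpose_mat H * H = Y * mat_diag r \<theta> * (transpose_mat H * H)"
    using Y H by (intro assoc_mult_mat[of _ "dim_row B" r _ "dim_col B" _ r]) auto
  then have "B * H = Y * mat_diag r \<theta>"
    unfolding B[symmetric] HH using right_mult_one_mat[of "Y * mat_diag r \<theta>" "dim_row B" r] Y by simp
  moreover have "col (B * H) i = B *\<^sub>v col H i" by (rule col_mult2[OF carrier_matI[OF refl refl] H assms(2)])
  moreover have "col (Y * mat_diag r \<theta>) i = \<theta> i \<cdot>\<^sub>v col Y i"
    unfolding mat_diag_mult_right[OF Y] using Y assms(2) by (intro eq_vecI) auto
  ultimately show ?thesis by simp
qed

text \<open>Transposition exchanges the roles of \<open>Y\<close> and \<open>H\<close>, so the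
  relation for the left singular vectors is the relation for the right ones applied to the
  transpose.\<close>

lemma compact_svd_transpose:
  assumes "compact_svd B r Y \<theta> H"
  shows "compact_svd (transpose_mat B) r H \<theta> Y"
proof -
  have Y: "Y \<in> carrier_mat (dim_row B) r" and H: "H \<in> carrier_mat (dim_col B) r"
    and B: "B = Y * mat_diag r \<theta> * transpose_mat H"
    using assms by (auto simp: compact_svd_def)
  have D: "transpose_mat (mat_diag r \<theta>) = mat_diag r \<theta>"
    by (intro eq_matI) (auto simp: mat_diag_def)
  have "transpose_mat B = transpose_mat (Y * mat_diag r \<theta> * transpose_mat H)"
    using B by simp
  also have "\<dots> = H * transpose_mat (Y * mat_diag r \<theta>)"
    using Y H by (subst transpose_mult[of _ "dim_row B" r _ "dim_col B"]) auto
  also have "\<dots> = H * (mat_diag r \<theta> * transpose_mat Y)"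
    using transpose_mult[OF Y mat_diag_dim] D by simp
  also have "\<dots> = H * mat_diag r \<theta> * transpose_mat Y"
    using Y H by (intro assoc_mult_mat[symmetric]) auto
  finally show ?thesis using assms by (auto simp: compact_svd_def)
qed

lemma compact_svd_left:
  assumes "compact_svd B r Y \<theta> H" and "i < r"
  shows "transpose_mat B *\<^sub>v col Y i = \<theta> i \<cdot>\<^sub>v col H i"
  using compact_svd_right[OF compact_svd_transpose[OF assms(1)] assms(2)] .

lemma compact_svd_unit_cols:
  assumes "compact_svd B r Y \<theta> H" and "i < r"
  shows "col H i \<bullet> col H i = 1" and "col Y i \<bullet> col Y i = 1"
proof -
  have "(transpose_mat H * H) $$ (i, i) = 1" "(transpose_mat Y * Y) $$ (i, i) = 1"
    using assms by (auto simp: compact_svd_def)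
  moreover have "dim_col H = r" "dim_col Y = r" using assms by (auto simp: compact_svd_def)
  ultimately show "col H i \<bullet> col H i = 1" "col Y i \<bullet> col Y i = 1"
    using assms(2) by auto
qed

section \<open>The semi-inner product of \<open>M\<close> and its pseudoinverse\<close>

locale gGKB_process =
  fixes A L M :: "real mat" and b :: "real vec" and m n p :: nat
  assumes A: "A \<in> carrier_mat m n" and L: "L \<in> carrier_mat p n"
    and M_eq: "M = transpose_mat A * A + transpose_mat L * L"
    and b: "b \<in> carrier_vec m"
begin

abbreviation "\<alpha> \<equiv> gGKB_alpha A M b"
abbreviation "\<beta> \<equiv> gGKB_beta A M b"
abbreviation "u \<equiv> gGKB_u A M b"
abbreviation "v \<equiv> gGKB_v A M b"

lemma transpose_A: "transpose_mat A \<in> carrier_mat n m"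
  using A by simp

lemma M: "M \<in> carrier_mat n n"
  using A L by (simp add: M_eq)

lemma M_mult_vec:
  assumes "x \<in> carrier_vec n"
  shows "M *\<^sub>v x = transpose_mat A *\<^sub>v (A *\<^sub>v x) + transpose_mat L *\<^sub>v (L *\<^sub>v x)"
  using assms A L unfolding M_eq by (subst add_mult_distrib_mat_vec[of _ n n]) auto

text \<open>The form of \<open>M\<close> is the sum of two Euclidean inner products pulled back
  along \<open>A\<close> and \<open>L\<close>. Symmetry, semidefiniteness and the bound of
  \<open>A\<close> by the seminorm all come from this.\<close>

lemma M_form:
  assumes "x \<in> carrier_vec n" and "y \<in> carrier_vec n"
  shows "x \<bullet> (M *\<^sub>v y) = (A *\<^sub>v x) \<bullet> (A *\<^sub>v y) + (L *\<^sub>v x) \<bullet> (L *\<^sub>v y)"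
  using assms A L
  by (simp add: M_mult_vec scalar_prod_add_distrib[of _ n] scalar_prod_mult_mat_vec[of A m n]
      scalar_prod_mult_mat_vec[of L p n])

lemma M_form_commute:
  assumes "x \<in> carrier_vec n" and "y \<in> carrier_vec n"
  shows "x \<bullet> (M *\<^sub>v y) = y \<bullet> (M *\<^sub>v x)"
  using assms A L comm_scalar_prod[of "A *\<^sub>v x" m "A *\<^sub>v y"]
    comm_scalar_prod[of "L *\<^sub>v x" p "L *\<^sub>v y"]
  by (simp add: M_form)

text \<open>What is dropped is the square of the norm of \<open>L *\<^sub>v x\<close>. This estimate
  later bounds \<theta> by 1.\<close>

lemma M_form_ge:
  assumes "x \<in> carrier_vec n"
  shows "(A *\<^sub>v x) \<bullet> (A *\<^sub>v x) \<le> x \<bullet> (M *\<^sub>v x)"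
  using assms by (simp add: M_form scalar_prod_self_nonneg)

lemma normM_sq:
  assumes "x \<in> carrier_vec n"
  shows "(normM M x)\<^sup>2 = x \<bullet> (M *\<^sub>v x)"
  using M_form_ge[OF assms] scalar_prod_self_nonneg[of "A *\<^sub>v x"] by (simp add: normM_def)

text \<open>Two squares with sum zero both vanish. Since \<open>M\<close> may be singular,
  \<open>x\<close> itself can be nonzero, but its images under \<open>A\<close> and \<open>M\<close>
  are zero.\<close>

lemma M_form_eq_0:
  assumes x: "x \<in> carrier_vec n" and "x \<bullet> (M *\<^sub>v x) = 0"
  shows "A *\<^sub>v x = 0\<^sub>v m" and "M *\<^sub>v x = 0\<^sub>v n"
proof -
  have "(A *\<^sub>v x) \<bullet> (A *\<^sub>v x) = 0" "(L *\<^sub>v x) \<bullet> (L *\<^sub>v x) = 0"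
    using assms scalar_prod_self_nonneg[of "A *\<^sub>v x"] scalar_prod_self_nonneg[of "L *\<^sub>v x"]
    by (auto simp: M_form)
  then have 0: "A *\<^sub>v x = 0\<^sub>v m" "L *\<^sub>v x = 0\<^sub>v p"
    using scalar_prod_self_eq_0[of "A *\<^sub>v x" m] scalar_prod_self_eq_0[of "L *\<^sub>v x" p] A L x by auto
  then show "A *\<^sub>v x = 0\<^sub>v m" "M *\<^sub>v x = 0\<^sub>v n"
    using x A L by (auto simp: M_mult_vec mult_mat_zero_vec[of _ n])
qed

lemma transpose_M: "transpose_mat M = M"
proof (rule eq_matI)
  fix i j assume ij: "i < dim_row M" "j < dim_col M"
  then have "unit_vec n j \<bullet> (M *\<^sub>v unit_vec n i) = unit_vec n i \<bullet> (M *\<^sub>v unit_vec n j)"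
    by (intro M_form_commute) auto
  then show "transpose_mat M $$ (i, j) = M $$ (i, j)"
    using ij M by (simp add: mult_mat_unit_vec)
qed (use M in auto)

lemma pinv_M: "pinv M \<in> carrier_mat n n"
  using is_pinv_pinv[of M] M by (auto simp: is_pinv_def)

lemma M_M_pinv: "M * (M * pinv M) = M"
proof -
  let ?X = "pinv M"
  have X: "M * ?X * M = M" "transpose_mat (M * ?X) = M * ?X"
    using is_pinv_pinv[of M] by (auto simp: is_pinv_def)
  have "transpose_mat (M * ?X * M) = transpose_mat M * transpose_mat (M * ?X)"
    using M pinv_M by (intro transpose_mult[of _ n n _ n]) auto
  then show ?thesis using X by (simp add: transpose_M)
qed

text \<open>The range of the transpose of \<open>A\<close> lies in the range of \<open>M\<close>,
  where \<open>M * pinv M\<close> acts as the identity. The residual \<open>d\<close> is in the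
  kernel of \<open>M\<close>, hence in that of \<open>A\<close>, and so is orthogonal to both of its
  own terms.\<close>

lemma M_pinv_range:
  assumes y: "y \<in> carrier_vec m"
  shows "M *\<^sub>v (pinv M *\<^sub>v (transpose_mat A *\<^sub>v y)) = transpose_mat A *\<^sub>v y"
proof -
  define w where "w = transpose_mat A *\<^sub>v y"
  define q where "q = pinv M *\<^sub>v w"
  define d where "d = w - M *\<^sub>v q"
  have w: "w \<in> carrier_vec n" using A y by (simp add: w_def)
  have q: "q \<in> carrier_vec n" using pinv_M w by (simp add: q_def)
  have Mq: "M *\<^sub>v q \<in> carrier_vec n" using M q by simp
  have d: "d \<in> carrier_vec n" using w Mq by (simp add: d_def)
  have "M *\<^sub>v (M *\<^sub>v q) = (M * (M * pinv M)) *\<^sub>v w"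
    using M pinv_M w by (simp add: q_def assoc_mult_mat_vec[of _ n n _ n])
  also have "\<dots> = M *\<^sub>v w" by (simp only: M_M_pinv)
  finally have Md: "M *\<^sub>v d = 0\<^sub>v n"
    using M w Mq by (simp add: d_def mult_minus_distrib_mat_vec[of _ n n])
  have Ad: "A *\<^sub>v d = 0\<^sub>v m"
    using d by (intro M_form_eq_0(1)) (simp_all add: Md)
  \<comment> \<open>Moving \<open>M\<close> and the transpose of \<open>A\<close> onto
    \<open>d\<close> turns the two terms into products with \<open>A *\<^sub>v d\<close> and
    \<open>M *\<^sub>v d\<close>, which are zero.\<close>
  have "d \<bullet> d = d \<bullet> w - d \<bullet> (M *\<^sub>v q)"
    using d w Mq scalar_prod_minus_distrib[OF d w Mq] by (simp add: d_def)
  also have "\<dots> = 0"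
    using M_form_commute[OF d q] scalar_prod_mult_mat_vec[OF A d y] q y
    by (simp add: w_def Md Ad)
  finally have "d = 0\<^sub>v n" by (rule scalar_prod_self_eq_0[OF d])
  then have "w $ i - (M *\<^sub>v q) $ i = 0" if "i < n" for i
    using that M index_minus_vec(1)[of i "M *\<^sub>v q" w] by (simp add: d_def[symmetric])
  then have "M *\<^sub>v q = w" using w M by (intro eq_vecI) auto
  then show ?thesis by (simp add: q_def w_def)
qed

section \<open>The recurrences of the process, valid also at termination\<close>

lemma u_v_0: "u 0 = 0\<^sub>v m" "v 0 = 0\<^sub>v n"
  using A by (auto simp: gGKB_u_def gGKB_v_def)

text \<open>The vector before normalization. The index is that of the preceding step:
  \<open>u_rhs i\<close> yields \<open>u (Suc i)\<close>, and likewise \<open>v_rhs i\<close> yields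
  \<open>v (Suc i)\<close>.\<close>

definition "u_rhs i = (if i = 0 then b else A *\<^sub>v v i - \<alpha> i \<cdot>\<^sub>v u i)"

definition "v_rhs i = pinv M *\<^sub>v (transpose_mat A *\<^sub>v u (Suc i)) - \<beta> (Suc i) \<cdot>\<^sub>v v i"

lemma process_Suc:
  "\<beta> (Suc i) = norm2 (u_rhs i)"
  "u (Suc i) = (1 / \<beta> (Suc i)) \<cdot>\<^sub>v u_rhs i"
  "\<alpha> (Suc i) = normM M (v_rhs i)"
  "v (Suc i) = (1 / \<alpha> (Suc i)) \<cdot>\<^sub>v v_rhs i"
  unfolding u_rhs_def v_rhs_def gGKB_alpha_def gGKB_beta_def gGKB_u_def gGKB_v_def
  by (simp_all add: Let_def split: prod.split)

lemma u_v_carrier: "u i \<in> carrier_vec m \<and> v i \<in> carrier_vec n"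
proof (induction i)
  case 0
  show ?case by (simp add: u_v_0)
next
  case (Suc i)
  have "u_rhs i \<in> carrier_vec m" using A b Suc by (simp add: u_rhs_def)
  then have u: "u (Suc i) \<in> carrier_vec m" by (simp add: process_Suc)
  then have "v_rhs i \<in> carrier_vec n" using A Suc pinv_M by (simp add: v_rhs_def)
  then show ?case using u by (simp add: process_Suc(4))
qed

lemma u: "u i \<in> carrier_vec m" and v: "v i \<in> carrier_vec n"
  using u_v_carrier by auto

lemma u_rhs: "u_rhs i \<in> carrier_vec m"
  using A b u v by (simp add: u_rhs_def)

lemma v_rhs: "v_rhs i \<in> carrier_vec n"
  using A u v pinv_M by (simp add: v_rhs_def)

text \<open>The division by \<open>\<beta> (Suc i)\<close> can be undone even when it is 0, because
  the Euclidean norm vanishes only at the zero vector.\<close>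

lemma beta_u: "\<beta> (Suc i) \<cdot>\<^sub>v u (Suc i) = u_rhs i"
proof (cases "\<beta> (Suc i) = 0")
  case True
  then have "u_rhs i \<bullet> u_rhs i = 0" using norm2_sq[of "u_rhs i"] by (simp add: process_Suc(1))
  then have "u_rhs i = 0\<^sub>v m" by (rule scalar_prod_self_eq_0[OF u_rhs])
  then show ?thesis using True u[of "Suc i"] by (intro eq_vecI) auto
next
  case False
  then show ?thesis by (simp add: process_Suc(2) smult_smult_assoc)
qed

lemma A_v:
  assumes "i \<ge> 1"
  shows "A *\<^sub>v v i = \<beta> (Suc i) \<cdot>\<^sub>v u (Suc i) + \<alpha> i \<cdot>\<^sub>v u i"
  using assms A u[of i] unfolding beta_u by (intro eq_vecI) (auto simp: u_rhs_def)

text \<open>In the case \<open>\<alpha>\<^bsub>i+1\<^esub> = 0\<close> the right-hand side \<open>z\<close> has \<open>\<parallel>z\<parallel>\<^sub>M = 0\<close>,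
  which suffices for \<open>M z = 0\<close>.\<close>

lemma alpha_M_v: "\<alpha> (Suc i) \<cdot>\<^sub>v (M *\<^sub>v v (Suc i)) = M *\<^sub>v v_rhs i"
proof (cases "\<alpha> (Suc i) = 0")
  case True
  then have "v_rhs i \<bullet> (M *\<^sub>v v_rhs i) = 0"
    using normM_sq[OF v_rhs, of i] by (simp add: process_Suc(3))
  then have "M *\<^sub>v v_rhs i = 0\<^sub>v n" by (rule M_form_eq_0(2)[OF v_rhs])
  then show ?thesis using True M by (intro eq_vecI) auto
next
  case False
  then show ?thesis
    by (simp add: process_Suc(4) mult_mat_vec[OF M v_rhs] smult_smult_assoc)
qed

text \<open>The recurrence for \<open>v\<close> multiplied by \<open>M\<close>, which removes the
  pseudoinverse by \<open>M_pinv_range\<close>.\<close>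

lemma transpose_A_u:
  "transpose_mat A *\<^sub>v u (Suc i) =
    \<alpha> (Suc i) \<cdot>\<^sub>v (M *\<^sub>v v (Suc i)) + \<beta> (Suc i) \<cdot>\<^sub>v (M *\<^sub>v v i)"
proof -
  have "M *\<^sub>v v_rhs i = transpose_mat A *\<^sub>v u (Suc i) - \<beta> (Suc i) \<cdot>\<^sub>v (M *\<^sub>v v i)"
    unfolding v_rhs_def using A M pinv_M u v
    by (simp add: mult_minus_distrib_mat_vec[of _ n n] mult_mat_vec[of _ n n] M_pinv_range
        del: assoc_mult_mat_vec)
  then show ?thesis
    unfolding alpha_M_v using A M by (intro eq_vecI) auto
qed

section \<open>Normalization and orthogonality of the generated vectors\<close>

lemma u_u_eq_1:
  assumes "\<beta> (Suc i) \<noteq> 0"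
  shows "u (Suc i) \<bullet> u (Suc i) = 1"
proof -
  have "(\<beta> (Suc i))\<^sup>2 = u_rhs i \<bullet> u_rhs i" by (simp add: process_Suc(1) norm2_sq)
  also have "\<dots> = (\<beta> (Suc i))\<^sup>2 * (u (Suc i) \<bullet> u (Suc i))"
    using u[of "Suc i"] unfolding beta_u[symmetric] by (simp add: power2_eq_square)
  finally show ?thesis using assms by simp
qed

lemma v_v_eq_1:
  assumes "\<alpha> (Suc i) \<noteq> 0"
  shows "v (Suc i) \<bullet> (M *\<^sub>v v (Suc i)) = 1"
proof -
  have "(\<alpha> (Suc i))\<^sup>2 = v_rhs i \<bullet> (M *\<^sub>v v_rhs i)" by (simp add: process_Suc(3) normM_sq[OF v_rhs])
  moreover have "v (Suc i) \<bullet> (M *\<^sub>v v (Suc i)) = (v_rhs i \<bullet> (M *\<^sub>v v_rhs i)) / (\<alpha> (Suc i))\<^sup>2"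
    using M v_rhs[of i]
    by (simp add: process_Suc(4) mult_mat_vec[OF M v_rhs] smult_scalar_prod_distrib[of _ n] power2_eq_square)
  ultimately have "v (Suc i) \<bullet> (M *\<^sub>v v (Suc i)) = (\<alpha> (Suc i))\<^sup>2 / (\<alpha> (Suc i))\<^sup>2"
    by (simp only:)
  then show ?thesis using assms by simp
qed

lemma u_zero:
  assumes "\<beta> (Suc i) = 0"
  shows "u (Suc i) = 0\<^sub>v m"
  using assms u_rhs[of i] by (intro eq_vecI) (auto simp: process_Suc(2))

lemma v_zero:
  assumes "\<alpha> (Suc i) = 0"
  shows "v (Suc i) = 0\<^sub>v n"
  using assms v_rhs[of i] by (intro eq_vecI) (auto simp: process_Suc(4))

text \<open>Both sides compute \<open>u\<^sub>i \<bullet> A v\<^sub>j\<close>.\<close>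

lemma gram_recurrence:
  assumes "j \<ge> 1"
  shows "\<alpha> (Suc i) * (v (Suc i) \<bullet> (M *\<^sub>v v j)) + \<beta> (Suc i) * (v i \<bullet> (M *\<^sub>v v j)) =
    \<beta> (Suc j) * (u (Suc i) \<bullet> u (Suc j)) + \<alpha> j * (u (Suc i) \<bullet> u j)"
proof -
  have "v j \<bullet> (transpose_mat A *\<^sub>v u (Suc i)) = (A *\<^sub>v v j) \<bullet> u (Suc i)"
    by (rule scalar_prod_mult_mat_vec[OF A v u])
  moreover have "v j \<bullet> (transpose_mat A *\<^sub>v u (Suc i)) =
      \<alpha> (Suc i) * (v (Suc i) \<bullet> (M *\<^sub>v v j)) + \<beta> (Suc i) * (v i \<bullet> (M *\<^sub>v v j))"
    unfolding transpose_A_u using M v M_form_commute[OF v[of j] v]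
    by (simp add: scalar_prod_add_distrib[of _ n] scalar_prod_smult_distrib[of _ n])
  moreover have "(A *\<^sub>v v j) \<bullet> u (Suc i) =
      \<beta> (Suc j) * (u (Suc i) \<bullet> u (Suc j)) + \<alpha> j * (u (Suc i) \<bullet> u j)"
    unfolding A_v[OF assms] using u comm_scalar_prod[OF u[of "Suc i"] u]
    by (simp add: add_scalar_prod_distrib[of _ m] smult_scalar_prod_distrib[of _ m])
  ultimately show ?thesis by simp
qed

text \<open>Strong induction on the larger index through \<open>gram_recurrence\<close>, first for
  the \<open>u\<close> vectors and then, using these, for the \<open>v\<close> vectors. Index 0
  gives zero vectors; index \<open>Suc k\<close> is included although its vectors may be zero by the
  termination convention.\<close>

lemma orthogonal:
  assumes "\<forall>i\<in>{1..k}. \<alpha> i \<noteq> 0 \<and> \<beta> i \<noteq> 0" and "j < i" and "i \<le> Suc k"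
  shows "u i \<bullet> u j = 0 \<and> v i \<bullet> (M *\<^sub>v v j) = 0"
  using assms(2,3)
proof (induction i arbitrary: j rule: less_induct)
  case (less i)
  show ?case
  proof (cases "j = 0")
    case True
    then show ?thesis using M u v by (simp add: u_v_0 mult_mat_zero_vec)
  next
    case False
    with less.prems obtain t where t: "i = Suc t" "t \<ge> 1" "t \<le> k" "j \<le> t"
      by (cases i) auto
    have tt: "u t \<bullet> u t = 1" "v t \<bullet> (M *\<^sub>v v t) = 1"
      using u_u_eq_1[of "t - 1"] v_v_eq_1[of "t - 1"] assms(1) t by auto
    have U: "u a \<bullet> u c = 0" and V: "v a \<bullet> (M *\<^sub>v v c) = 0" if "a \<le> t" "c \<le> t" "a \<noteq> c" for a c
    proof -
      have "a < c \<or> c < a" using that by auto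
      then show "u a \<bullet> u c = 0" "v a \<bullet> (M *\<^sub>v v c) = 0"
        using less.IH[of a c] less.IH[of c a] that t comm_scalar_prod[OF u u, of a c]
          M_form_commute[OF v v, of a c] by auto
    qed
    have u0: "u i \<bullet> u a = 0" if "a \<ge> 1" "a \<le> t" for a
    proof (cases "\<beta> i = 0")
      case True
      then show ?thesis using u by (simp add: u_zero t)
    next
      case False
      obtain a' where a': "a = Suc a'" using \<open>a \<ge> 1\<close> by (cases a) auto
      \<comment> \<open>In row \<open>a\<close> of the recurrence the term with \<open>v a'\<close>
        drops out because \<open>a' < t\<close>. The two remaining products are both 0 for
        \<open>a < t\<close>; for \<open>a = t\<close> both equal \<open>\<alpha> t\<close> and
        cancel.\<close>
      have "\<beta> i * (u a \<bullet> u i) = \<alpha> a * (v a \<bullet> (M *\<^sub>v v t)) - \<alpha> t * (u a \<bullet> u t)"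
        using gram_recurrence[of t a'] V[of a' t] t a' that by simp
      also have "\<dots> = 0" using U[of a t] V[of a t] tt that by (cases "a = t") auto
      finally show ?thesis using False comm_scalar_prod[OF u u, of i a] by simp
    qed
    have "v i \<bullet> (M *\<^sub>v v j) = 0"
    proof (cases "\<alpha> i = 0")
      case True
      then show ?thesis using v M by (simp add: v_zero t)
    next
      case ai: False
      \<comment> \<open>For \<open>j < t\<close> both products on the right vanish. For
        \<open>j = t\<close> they are \<beta>-multiples of unit squared norms and cancel; if
        \<open>\<beta> i = 0\<close>, both terms are already 0.\<close>
      have "\<alpha> i * (v i \<bullet> (M *\<^sub>v v j)) = \<beta> (Suc j) * (u i \<bullet> u (Suc j)) - \<beta> i * (v t \<bullet> (M *\<^sub>v v j))"
        using gram_recurrence[of j t] u0[of j] False t by simp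
      also have "\<dots> = 0"
      proof (cases "j = t")
        case True
        then show ?thesis using tt t u_u_eq_1[of t] by (cases "\<beta> i = 0") auto
      next
        case False
        then show ?thesis using u0[of "Suc j"] V[of t j] t by simp
      qed
      finally show ?thesis using ai by simp
    qed
    then show ?thesis using u0[of j] False t by simp
  qed
qed

section \<open>Matrix form of the recurrences\<close>

lemma U: "gGKB_U A M b k \<in> carrier_mat m k"
  using A mat_of_cols_carrier(1)[of m "map u [1..<Suc k]"] by (simp add: gGKB_U_def del: upt_Suc)

lemma V: "gGKB_V A M b k \<in> carrier_mat n k"
  using A mat_of_cols_carrier(1)[of n "map v [1..<Suc k]"] by (simp add: gGKB_V_def del: upt_Suc)

lemma B: "gGKB_B A M b k \<in> carrier_mat (k + 1) k"
  by (simp add: gGKB_B_def)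

lemma col_U: "j < k \<Longrightarrow> col (gGKB_U A M b k) j = u (Suc j)"
  using A u by (simp add: gGKB_U_def del: upt_Suc)

lemma col_V: "j < k \<Longrightarrow> col (gGKB_V A M b k) j = v (Suc j)"
  using A v by (simp add: gGKB_V_def del: upt_Suc)

lemma A_V: "A * gGKB_V A M b k = gGKB_U A M b (k + 1) * gGKB_B A M b k"
proof (rule mat_col_eqI)
  let ?U = "gGKB_U A M b (k + 1)"
  fix j assume "j < dim_col (?U * gGKB_B A M b k)"
  then have j: "j < k" by (simp add: gGKB_B_def)
  have "col (gGKB_B A M b k) j =
      \<beta> (Suc (Suc j)) \<cdot>\<^sub>v unit_vec (k + 1) (Suc j) + \<alpha> (Suc j) \<cdot>\<^sub>v unit_vec (k + 1) j"
    using j by (intro eq_vecI) (auto simp: gGKB_B_def)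
  then have "?U *\<^sub>v col (gGKB_B A M b k) j =
      \<beta> (Suc (Suc j)) \<cdot>\<^sub>v u (Suc (Suc j)) + \<alpha> (Suc j) \<cdot>\<^sub>v u (Suc j)"
    using j by (simp add: mult_add_distrib_mat_vec[OF U] mult_mat_vec[OF U] mult_mat_unit_vec[OF U] col_U)
  then show "col (A * gGKB_V A M b k) j = col (?U * gGKB_B A M b k) j"
    using j by (simp only: col_mult2[OF A V] col_mult2[OF U B] col_V) (simp add: A_v)
qed (use A U[of "k + 1"] V[of k] B[of k] in auto)

lemma transpose_A_U:
  assumes y: "y \<in> carrier_vec (k + 1)"
  shows "transpose_mat A *\<^sub>v (gGKB_U A M b (k + 1) *\<^sub>v y) =
    M *\<^sub>v (gGKB_V A M b k *\<^sub>v (transpose_mat (gGKB_B A M b k) *\<^sub>v y)) +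
    (\<alpha> (k + 1) * y $ k) \<cdot>\<^sub>v (M *\<^sub>v v (k + 1))"
proof -
  let ?U = "gGKB_U A M b (k + 1)" and ?V = "gGKB_V A M b k" and ?B = "gGKB_B A M b k"
  \<comment> \<open>The remainder of rank at most one. Only its last column can be nonzero:
    \<open>\<alpha> (k + 1)\<close> would sit in column \<open>k\<close> of \<open>B\<close>,
    outside the matrix.\<close>
  define R where "R = mat n (k + 1) (\<lambda>(i, j). if j = k then \<alpha> (k + 1) * (M *\<^sub>v v (k + 1)) $ i else 0)"
  have R: "R \<in> carrier_mat n (k + 1)" by (simp add: R_def)
  have MV: "M * ?V \<in> carrier_mat n k" using M V by simp
  have BT: "transpose_mat ?B \<in> carrier_mat k (k + 1)" using B by simp
  have MVB: "M * ?V * transpose_mat ?B \<in> carrier_mat n (k + 1)" using MV BT by simp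
  have "transpose_mat A * ?U = M * ?V * transpose_mat ?B + R"
  proof (rule mat_col_eqI)
    fix j assume "j < dim_col (M * ?V * transpose_mat ?B + R)"
    then have j: "j < k + 1" by (simp add: R_def)
    \<comment> \<open>The \<beta> part of column \<open>j\<close> of the transposed
      \<open>B\<close>. Column 0 has no such entry, which agrees with \<open>v 0\<close> being
      zero.\<close>
    have prev: "(M * ?V) *\<^sub>v (if j = 0 then 0\<^sub>v k else \<beta> (Suc j) \<cdot>\<^sub>v unit_vec k (j - 1)) =
        \<beta> (Suc j) \<cdot>\<^sub>v (M *\<^sub>v v j)"
    proof (cases "j = 0")
      case True
      then show ?thesis using M by (simp add: mult_mat_zero_vec[OF MV] mult_mat_zero_vec[OF M] u_v_0)
        (intro eq_vecI, auto)
    next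
      case False
      then show ?thesis using j
        by (simp add: mult_mat_vec[OF MV] mult_mat_unit_vec[OF MV] col_mult2[OF M V] col_V
            del: assoc_mult_mat_vec)
    qed
    \<comment> \<open>The \<alpha> part of the same column. It is absent in the last column, where
      \<open>R\<close> supplies the missing term.\<close>
    define g where "g = (if j = k then 0\<^sub>v k else \<alpha> (Suc j) \<cdot>\<^sub>v unit_vec k j)"
    have g: "(M * ?V) *\<^sub>v g \<in> carrier_vec n" by (rule mult_mat_vec_carrier[OF MV]) (simp add: g_def)
    have "col (transpose_mat ?B) j =
        g + (if j = 0 then 0\<^sub>v k else \<beta> (Suc j) \<cdot>\<^sub>v unit_vec k (j - 1))"
      using j by (intro eq_vecI) (auto simp: gGKB_B_def g_def)
    then have col_MVB: "col (M * ?V * transpose_mat ?B) j =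
        (M * ?V) *\<^sub>v g + \<beta> (Suc j) \<cdot>\<^sub>v (M *\<^sub>v v j)"
      using j by (simp only: col_mult2[OF MV BT])
        (subst mult_add_distrib_mat_vec[OF MV],
          auto simp: g_def prev[symmetric] simp del: assoc_mult_mat_vec)
    have col_R: "(M * ?V) *\<^sub>v g + col R j = \<alpha> (Suc j) \<cdot>\<^sub>v (M *\<^sub>v v (Suc j))"
    proof (cases "j = k")
      case True
      then show ?thesis using M j
        by (intro eq_vecI) (auto simp: g_def mult_mat_zero_vec[OF MV] R_def)
    next
      case False
      have "col R j = 0\<^sub>v n" using False j by (intro eq_vecI) (auto simp: R_def)
      then show ?thesis using j False M v
        by (simp add: g_def mult_mat_vec[OF MV] mult_mat_unit_vec[OF MV] col_mult2[OF M V] col_V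
            del: assoc_mult_mat_vec)
    qed
    have "col (transpose_mat A * ?U) j = \<alpha> (Suc j) \<cdot>\<^sub>v (M *\<^sub>v v (Suc j)) + \<beta> (Suc j) \<cdot>\<^sub>v (M *\<^sub>v v j)"
      unfolding col_mult2[OF transpose_A U j] col_U[OF j] by (rule transpose_A_u)
    also have "\<dots> = col (M * ?V * transpose_mat ?B) j + col R j"
      unfolding col_R[symmetric] col_MVB using g M R by (intro eq_vecI) (auto simp: add_ac)
    also have "\<dots> = col (M * ?V * transpose_mat ?B + R) j"
      using j MVB R by (intro eq_vecI) auto
    finally show "col (transpose_mat A * ?U) j = col (M * ?V * transpose_mat ?B + R) j" .
  qed (use A U[of "k + 1"] MVB R in auto)
  then have "transpose_mat A *\<^sub>v (?U *\<^sub>v y) = (M * ?V * transpose_mat ?B + R) *\<^sub>v y"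
    using assoc_mult_mat_vec[OF transpose_A U y] by simp
  also have "\<dots> = M *\<^sub>v (?V *\<^sub>v (transpose_mat ?B *\<^sub>v y)) + R *\<^sub>v y"
    using y BT assoc_mult_mat_vec[OF MV BT y] assoc_mult_mat_vec[OF M V, of "transpose_mat ?B *\<^sub>v y"]
    by (simp add: add_mult_distrib_mat_vec[OF MVB R y])
  also have "R *\<^sub>v y = (\<alpha> (k + 1) * y $ k) \<cdot>\<^sub>v (M *\<^sub>v v (k + 1))"
    using y M by (intro eq_vecI)
      (auto simp: R_def scalar_prod_def if_distrib[of "\<lambda>x. x * _"] cong: if_cong)
  finally show ?thesis .
qed

section \<open>Isometry of \<open>V\<close> and \<open>U\<close>, and the last row of
  \<open>B\<close>\<close>

lemma V_isometric:
  assumes nt: "\<forall>i\<in>{1..k}. \<alpha> i \<noteq> 0 \<and> \<beta> i \<noteq> 0" and h: "h \<in> carrier_vec k"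
  shows "(gGKB_V A M b k *\<^sub>v h) \<bullet> (M *\<^sub>v (gGKB_V A M b k *\<^sub>v h)) = h \<bullet> h"
proof -
  let ?V = "gGKB_V A M b k"
  have VT: "transpose_mat ?V \<in> carrier_mat k n" using V by simp
  have MV: "M * ?V \<in> carrier_mat n k" using M V by simp
  \<comment> \<open>The Gram matrix of the columns of \<open>V\<close> for the form of
    \<open>M\<close>; applied to \<open>h\<close> and paired with \<open>h\<close>, it gives the
    claim.\<close>
  have "transpose_mat ?V * (M * ?V) = 1\<^sub>m k"
  proof (rule eq_matI)
    fix i j assume "i < dim_row (1\<^sub>m k)" "j < dim_col (1\<^sub>m k)"
    then have ij: "i < k" "j < k" by auto
    then have "(transpose_mat ?V * (M * ?V)) $$ (i, j) = v (Suc i) \<bullet> (M *\<^sub>v v (Suc j))"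
      using V[of k] MV by (simp add: col_V col_mult2[OF M V])
    also have "\<dots> = (if i = j then 1 else 0)"
      using ij v_v_eq_1[of i] nt orthogonal[OF nt, of "Suc i" "Suc j"]
        orthogonal[OF nt, of "Suc j" "Suc i"] M_form_commute[OF v v, of "Suc i" "Suc j"]
      by (cases i j rule: linorder_cases) auto
    finally show "(transpose_mat ?V * (M * ?V)) $$ (i, j) = 1\<^sub>m k $$ (i, j)"
      using ij by simp
  qed (use V[of k] in auto)
  then have "h = transpose_mat ?V *\<^sub>v (M *\<^sub>v (?V *\<^sub>v h))"
    using assoc_mult_mat_vec[OF VT MV h] assoc_mult_mat_vec[OF M V h] h by simp
  then show ?thesis
    using scalar_prod_mult_mat_vec[OF V h, of "M *\<^sub>v (?V *\<^sub>v h)"] M h V[of k] by simp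
qed

text \<open>If \<open>\<beta>\<^bsub>k+1\<^esub> = 0\<close> then \<open>u\<^bsub>k+1\<^esub> = 0\<close> and \<open>U\<close> has no orthonormal columns, but then
  the last entry of every vector in the range of \<open>B\<close> is \<open>0\<close>.\<close>

lemma U_isometric_on_range_B:
  assumes nt: "\<forall>i\<in>{1..k}. \<alpha> i \<noteq> 0 \<and> \<beta> i \<noteq> 0" and z: "z \<in> carrier_vec (k + 1)"
    and last: "\<beta> (k + 1) = 0 \<Longrightarrow> z $ k = 0"
  shows "(gGKB_U A M b (k + 1) *\<^sub>v z) \<bullet> (gGKB_U A M b (k + 1) *\<^sub>v z) = z \<bullet> z"
proof -
  let ?U = "gGKB_U A M b (k + 1)"
  have UT: "transpose_mat ?U \<in> carrier_mat (k + 1) m" using U by simp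
  have "transpose_mat ?U * ?U = mat_diag (k + 1) (\<lambda>j. u (Suc j) \<bullet> u (Suc j))"
  proof (rule eq_matI)
    fix i j assume "i < dim_row (mat_diag (k + 1) (\<lambda>j. u (Suc j) \<bullet> u (Suc j)))"
      "j < dim_col (mat_diag (k + 1) (\<lambda>j. u (Suc j) \<bullet> u (Suc j)))"
    then have ij: "i < k + 1" "j < k + 1" by (auto simp: mat_diag_def)
    then have "(transpose_mat ?U * ?U) $$ (i, j) = u (Suc i) \<bullet> u (Suc j)"
      using U[of "k + 1"] by (simp add: col_U)
    also have "\<dots> = (if i = j then u (Suc j) \<bullet> u (Suc j) else 0)"
      using ij orthogonal[OF nt, of "Suc i" "Suc j"]
        orthogonal[OF nt, of "Suc j" "Suc i"] comm_scalar_prod[OF u u, of "Suc i" "Suc j"]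
      by (cases i j rule: linorder_cases) auto
    finally show "(transpose_mat ?U * ?U) $$ (i, j) =
        mat_diag (k + 1) (\<lambda>j. u (Suc j) \<bullet> u (Suc j)) $$ (i, j)"
      using ij by (simp add: mat_diag_def)
  qed (use U[of "k + 1"] in \<open>auto simp: mat_diag_def\<close>)
  \<comment> \<open>Every diagonal entry is 1 except possibly the last, and when that one is 0 the
    corresponding entry of \<open>z\<close> is 0 as well.\<close>
  moreover have "mat_diag (k + 1) (\<lambda>j. u (Suc j) \<bullet> u (Suc j)) *\<^sub>v z = z"
    unfolding mat_diag_mult_vec[OF z]
  proof (rule eq_vecI)
    fix j assume "j < dim_vec z"
    then have j: "j < k + 1" using z by simp
    have "\<beta> (Suc j) \<noteq> 0 \<or> z $ j = 0" using j nt last by (cases "j = k") auto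
    then show "vec (k + 1) (\<lambda>j. u (Suc j) \<bullet> u (Suc j) * z $ j) $ j = z $ j"
      using j u_u_eq_1[of j] by auto
  qed (use z in auto)
  ultimately have "transpose_mat ?U *\<^sub>v (?U *\<^sub>v z) = z"
    using assoc_mult_mat_vec[OF UT U z] by simp
  then show ?thesis
    using scalar_prod_mult_mat_vec[OF U z, of "?U *\<^sub>v z"] z U[of "k + 1"] by simp
qed

text \<open>The last row of \<open>B\<close> has its only possibly nonzero entry in the last column.
  With indices from 0, \<open>unit_vec k (k - 1)\<close> is the vector e_k.\<close>

lemma B_mult_last:
  assumes "k \<ge> 1" and "h \<in> carrier_vec k"
  shows "(gGKB_B A M b k *\<^sub>v h) $ k = \<beta> (k + 1) * (unit_vec k (k - 1) \<bullet> h)"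
proof -
  have "row (gGKB_B A M b k) k = \<beta> (k + 1) \<cdot>\<^sub>v unit_vec k (k - 1)"
    using assms by (intro eq_vecI) (auto simp: gGKB_B_def)
  moreover have "dim_row (gGKB_B A M b k) = k + 1" by (simp add: gGKB_B_def)
  ultimately show ?thesis using assms by simp
qed

end

section \<open>The residual identity for the approximate generalized singular vectors\<close>

theorem theorem5p2:
  fixes A L M Y H :: "real mat" and b :: "real vec" and m n p k :: nat
    and \<theta> cbar sbar :: "nat \<Rightarrow> real" and pbar xbar :: "nat \<Rightarrow> real vec"
  assumes "A \<in> carrier_mat m n" and "L \<in> carrier_mat p n"
    and "M = transpose_mat A * A + transpose_mat L * L"
    and "b \<in> carrier_vec m" and "b \<noteq> 0\<^sub>v m"
    and "k \<ge> 1"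
    and "\<forall>i\<in>{1..k}. gGKB_alpha A M b i * gGKB_beta A M b i \<noteq> 0"
    and "compact_svd (gGKB_B A M b k) k Y \<theta> H"
    and "\<forall>i<k. (cbar i, sbar i, pbar i, xbar i) =
           (\<theta> i, sqrt (1 - (\<theta> i)\<^sup>2), gGKB_U A M b (k + 1) *\<^sub>v col Y i, gGKB_V A M b k *\<^sub>v col H i)"
  shows "\<forall>i<k.
    (sbar i)\<^sup>2 \<cdot>\<^sub>v (transpose_mat A *\<^sub>v (A *\<^sub>v xbar i)) - (cbar i)\<^sup>2 \<cdot>\<^sub>v (transpose_mat L *\<^sub>v (L *\<^sub>v xbar i))
      = (gGKB_alpha A M b (k + 1) * gGKB_beta A M b (k + 1) * (unit_vec k (k - 1) \<bullet> col H i))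
          \<cdot>\<^sub>v (M *\<^sub>v gGKB_v A M b (k + 1))"
proof (intro allI impI)
  fix i assume i: "i < k"
  interpret gGKB_process A L M b m n p using assms(1-4) by unfold_locales
  let ?U = "gGKB_U A M b (k + 1)" and ?V = "gGKB_V A M b k" and ?B = "gGKB_B A M b k"
  note svd = assms(8)
  have nt: "\<forall>i\<in>{1..k}. \<alpha> i \<noteq> 0 \<and> \<beta> i \<noteq> 0" using assms(7) by auto
  have bars: "cbar i = \<theta> i" "sbar i = sqrt (1 - (\<theta> i)\<^sup>2)" "xbar i = ?V *\<^sub>v col H i"
    using assms(9) i by auto
  have y: "col Y i \<in> carrier_vec (k + 1)" and h: "col H i \<in> carrier_vec k"
    using svd B[of k] col_dim[of Y i] col_dim[of H i] by (auto simp: compact_svd_def simp del: col_dim)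
  have pos: "\<theta> i > 0" using svd i by (simp add: compact_svd_def)
  define x where "x = ?V *\<^sub>v col H i"
  have x: "x \<in> carrier_vec n" using V[of k] h by (simp add: x_def)
  have "A *\<^sub>v x = ?U *\<^sub>v (?B *\<^sub>v col H i)"
    using assoc_mult_mat_vec[OF A V h] assoc_mult_mat_vec[OF U B h] by (simp add: x_def A_V)
  then have Ax: "A *\<^sub>v x = \<theta> i \<cdot>\<^sub>v (?U *\<^sub>v col Y i)"
    unfolding compact_svd_right[OF svd i] mult_mat_vec[OF U y] .
  \<comment> \<open>The last entry of \<open>B h = \<theta> y\<close>. It serves twice: to show that
    the last entry of \<open>y\<close> vanishes when \<open>\<beta> (k + 1) = 0\<close>, and to
    introduce \<open>\<beta> (k + 1)\<close> and the last entry of \<open>h\<close> into the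
    residual.\<close>
  have last: "\<theta> i * col Y i $ k = \<beta> (k + 1) * (unit_vec k (k - 1) \<bullet> col H i)"
    using B_mult_last[OF assms(6) h] carrier_vecD[OF y]
    unfolding compact_svd_right[OF svd i] by (subst (asm) index_smult_vec(1)) (simp_all only: less_add_one)
  have "(A *\<^sub>v x) \<bullet> (A *\<^sub>v x) = (\<theta> i)\<^sup>2 * ((?U *\<^sub>v col Y i) \<bullet> (?U *\<^sub>v col Y i))"
    using U[of "k + 1"] y by (simp add: Ax power2_eq_square)
  also have "(?U *\<^sub>v col Y i) \<bullet> (?U *\<^sub>v col Y i) = 1"
  proof -
    have "col Y i $ k = 0" if "\<beta> (k + 1) = 0" using last pos that by (auto simp del: index_col)
    then show ?thesis
      using U_isometric_on_range_B[OF nt y] compact_svd_unit_cols(2)[OF svd i] by metis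
  qed
  finally have "(\<theta> i)\<^sup>2 \<le> x \<bullet> (M *\<^sub>v x)" using M_form_ge[OF x] by simp
  also have "\<dots> = 1"
    unfolding x_def using V_isometric[OF nt h] compact_svd_unit_cols(1)[OF svd i] by simp
  \<comment> \<open>The bound on \<theta> matters here: \<open>sqrt\<close> of a negative real is
    negative in HOL, so for \<theta> above 1 the square would be
    \<open>(\<theta> i)\<^sup>2 - 1\<close>.\<close>
  finally have s: "(sbar i)\<^sup>2 = 1 - (\<theta> i)\<^sup>2" by (simp add: bars)
  have ATA: "transpose_mat A *\<^sub>v (A *\<^sub>v x) = (\<theta> i)\<^sup>2 \<cdot>\<^sub>v (M *\<^sub>v x) +
      (\<alpha> (k + 1) * \<beta> (k + 1) * (unit_vec k (k - 1) \<bullet> col H i)) \<cdot>\<^sub>v (M *\<^sub>v v (k + 1))"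
  proof -
    have Uy: "?U *\<^sub>v col Y i \<in> carrier_vec m" using U[of "k + 1"] y by simp
    have "transpose_mat A *\<^sub>v (A *\<^sub>v x) = \<theta> i \<cdot>\<^sub>v (transpose_mat A *\<^sub>v (?U *\<^sub>v col Y i))"
      unfolding Ax by (rule mult_mat_vec[OF transpose_A Uy])
    \<comment> \<open>The matrix relation applied to \<open>y\<close>, with the transposed
      \<open>B\<close> sending \<open>y\<close> to \<theta> times \<open>h\<close>. The second
      factor \<theta>, from \<open>Ax\<close>, then multiplies the last entry of \<open>y\<close>,
      so that \<open>last\<close> applies.\<close>
    also have "transpose_mat A *\<^sub>v (?U *\<^sub>v col Y i) =
        \<theta> i \<cdot>\<^sub>v (M *\<^sub>v x) + (\<alpha> (k + 1) * col Y i $ k) \<cdot>\<^sub>v (M *\<^sub>v v (k + 1))"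
      unfolding transpose_A_U[OF y] compact_svd_left[OF svd i] mult_mat_vec[OF V h]
      using x by (simp add: x_def[symmetric] mult_mat_vec[OF M])
    also have "\<theta> i \<cdot>\<^sub>v \<dots> = (\<theta> i)\<^sup>2 \<cdot>\<^sub>v (M *\<^sub>v x) +
        (\<alpha> (k + 1) * (\<theta> i * col Y i $ k)) \<cdot>\<^sub>v (M *\<^sub>v v (k + 1))"
      using M by (intro eq_vecI) (auto simp: algebra_simps power2_eq_square)
    finally show ?thesis by (simp add: last mult.assoc)
  qed
  define P Q W where "P = transpose_mat A *\<^sub>v (A *\<^sub>v x)" and "Q = transpose_mat L *\<^sub>v (L *\<^sub>v x)"
    and "W = (\<alpha> (k + 1) * \<beta> (k + 1) * (unit_vec k (k - 1) \<bullet> col H i)) \<cdot>\<^sub>v (M *\<^sub>v v (k + 1))"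
  have dims: "dim_vec P = n" "dim_vec Q = n" "dim_vec W = n"
    using assms(1,2) M by (auto simp: P_def Q_def W_def)
  \<comment> \<open>Here \<open>M *\<^sub>v x\<close> is split into \<open>P + Q\<close>; collecting
    the multiples of \<open>P\<close> entry by entry gives the claimed form.\<close>
  have "P = (\<theta> i)\<^sup>2 \<cdot>\<^sub>v (P + Q) + W"
    using ATA M_mult_vec[OF x] by (simp add: P_def Q_def W_def)
  then have entry: "P $ j = (\<theta> i)\<^sup>2 * (P $ j + Q $ j) + W $ j" if "j < n" for j
    using that dims by (metis index_add_vec index_smult_vec(1))
  have "(1 - (\<theta> i)\<^sup>2) \<cdot>\<^sub>v P - (\<theta> i)\<^sup>2 \<cdot>\<^sub>v Q = W"
  proof (rule eq_vecI)
    fix j assume "j < dim_vec W"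
    then show "((1 - (\<theta> i)\<^sup>2) \<cdot>\<^sub>v P - (\<theta> i)\<^sup>2 \<cdot>\<^sub>v Q) $ j = W $ j"
      using dims entry[of j] by (simp add: algebra_simps)
  qed (simp add: dims)
  then show "(sbar i)\<^sup>2 \<cdot>\<^sub>v (transpose_mat A *\<^sub>v (A *\<^sub>v xbar i))
      - (cbar i)\<^sup>2 \<cdot>\<^sub>v (transpose_mat L *\<^sub>v (L *\<^sub>v xbar i))
      = (\<alpha> (k + 1) * \<beta> (k + 1) * (unit_vec k (k - 1) \<bullet> col H i)) \<cdot>\<^sub>v (M *\<^sub>v v (k + 1))"
    unfolding s bars(1,3) P_def Q_def W_def x_def .
qed

end
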